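(* For every integer $d\geq 3$, neither of the sets $\Pi_d\subset\mathbb{R}^{d-1}$ and $E_d\subset\mathbb{R}^{d-1}$ is semialgebraic.
   Context: $\Delta_{n-1}=\{x\in\mathbb{R}^n_{\geq 0}: x_1+\dots+x_n=1\}$. In $n$ variables, $p_k(x)=\sum_{i=1}^n x_i^k$ is the $k$-th power sum and $e_k(x)=\sum_{I\subset\{1,\dots,n\},|I|=k}\prod_{i\in I}x_i$ is the $k$-th elementary symmetric polynomial. For $n\ge d$ let $\Pi_{n,d}=(p_2,\dots,p_d)(\Delta_{n-1})$ and $E_{n,d}=(e_2,\dots,e_d)(\Delta_{n-1})$, both subsets of $\mathbb{R}^{d-1}$. For fixed $d$ these are increasing in $n$; $\Pi_d$ is the closure of $\bigcup_{n\ge d}\Pi_{n,d}$ and $E_d$ is the closure of $\bigcup_{n\ge d}E_{n,d}$. *)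

theory Defs
  imports "HOL-Homology.Simplices" "HOL-Library.Poly_Mapping"
begin

text \<open>
  Real affine space of dimension \<open>m\<close> is \<^term>\<open>Euclidean_space m\<close>: its points are the sequences
  \<open>x :: nat \<Rightarrow> real\<close> with \<open>x i = 0\<close> for \<open>i \<ge> m\<close>, so the coordinates are \<open>x 0, \<dots>, x (m - 1)\<close>.

  A real polynomial is a finitely supported map from exponent vectors to coefficients.
\<close>

definition poly_in_vars :: "nat \<Rightarrow> ((nat \<Rightarrow>\<^sub>0 nat) \<Rightarrow>\<^sub>0 real) \<Rightarrow> bool" where
  "poly_in_vars m f \<longleftrightarrow> (\<forall>a \<in> Poly_Mapping.keys f. Poly_Mapping.keys a \<subseteq> {..<m})"

definition poly_eval :: "((nat \<Rightarrow>\<^sub>0 nat) \<Rightarrow>\<^sub>0 real) \<Rightarrow> (nat \<Rightarrow> real) \<Rightarrow> real" where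
  "poly_eval f x =
     (\<Sum>a \<in> Poly_Mapping.keys f.
        Poly_Mapping.lookup f a * (\<Prod>i \<in> Poly_Mapping.keys a. x i ^ Poly_Mapping.lookup a i))"

text \<open>
  The semialgebraic subsets of \<open>m\<close>-space are the smallest Boolean algebra of subsets
  containing the sets \<open>{f > 0}\<close>, \<open>f\<close> a polynomial.
\<close>

inductive semialgebraic :: "nat \<Rightarrow> (nat \<Rightarrow> real) set \<Rightarrow> bool" for m :: nat where
  pos: "poly_in_vars m f \<Longrightarrow>
          semialgebraic m {x \<in> topspace (Euclidean_space m). 0 < poly_eval f x}"
| union: "semialgebraic m A \<Longrightarrow> semialgebraic m B \<Longrightarrow> semialgebraic m (A \<union> B)"
| inter: "semialgebraic m A \<Longrightarrow> semialgebraic m B \<Longrightarrow> semialgebraic m (A \<inter> B)"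
| compl: "semialgebraic m A \<Longrightarrow> semialgebraic m (topspace (Euclidean_space m) - A)"

definition power_sum :: "nat \<Rightarrow> nat \<Rightarrow> (nat \<Rightarrow> real) \<Rightarrow> real" where
  "power_sum n k x = (\<Sum>i<n. x i ^ k)"

definition elem_sym :: "nat \<Rightarrow> nat \<Rightarrow> (nat \<Rightarrow> real) \<Rightarrow> real" where
  "elem_sym n k x = (\<Sum>I \<in> {I. I \<subseteq> {..<n} \<and> card I = k}. \<Prod>i\<in>I. x i)"

text \<open>
  The simplex in \<open>n\<close> variables is \<^term>\<open>standard_simplex (n - 1)\<close> (for \<open>n \<ge> 1\<close>).
  Coordinate \<open>j < d - 1\<close> of an image point carries the polynomial of degree \<open>j + 2\<close>,
  so the degrees are \<open>2, \<dots>, d\<close>.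
\<close>

definition power_sum_image :: "nat \<Rightarrow> nat \<Rightarrow> (nat \<Rightarrow> real) set" where
  "power_sum_image n d =
     (\<lambda>x j. if j < d - 1 then power_sum n (j + 2) x else 0) ` standard_simplex (n - 1)"

definition elem_sym_image :: "nat \<Rightarrow> nat \<Rightarrow> (nat \<Rightarrow> real) set" where
  "elem_sym_image n d =
     (\<lambda>x j. if j < d - 1 then elem_sym n (j + 2) x else 0) ` standard_simplex (n - 1)"

definition power_sum_limit :: "nat \<Rightarrow> (nat \<Rightarrow> real) set" where
  "power_sum_limit d = Euclidean_space (d - 1) closure_of (\<Union>n\<in>{d..}. power_sum_image n d)"

definition elem_sym_limit :: "nat \<Rightarrow> (nat \<Rightarrow> real) set" where
  "elem_sym_limit d = Euclidean_space (d - 1) closure_of (\<Union>n\<in>{d..}. elem_sym_image n d)"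

end

theory Submission
  imports Defs "HOL-Computational_Algebra.Polynomial"
begin

text \<open>
  Each of the two sets is tested along a polynomial curve: \<open>t\<close> is sent to the point with
  coordinates \<open>p\<^sub>k = t\<^bsup>k - 1\<^esup>\<close>, respectively
  \<open>e\<^sub>k = (1 - t)(1 - 2 t) \<dots> (1 - (k - 1) t) / k!\<close>. For \<open>t = 1 / m\<close> this is the image of the
  vector with \<open>m\<close> entries \<open>1 / m\<close>, so the curve meets the limit set at every such \<open>t\<close>.

  Between these parameters the curve leaves the limit set. On the simplex,
  \<open>p\<^sub>3 - 2 t p\<^sub>2 + t\<^sup>2 = \<Sum>i. x\<^sub>i (x\<^sub>i - t)\<^sup>2\<close>, and if this is tiny then nearly all of the mass
  \<open>1\<close> is carried by entries close to \<open>t\<close>, so that \<open>1 / t\<close> is nearly an integer. Hence for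
  \<open>1 / (m + 1) < t < 1 / m\<close> this affine functional of \<open>(p\<^sub>2, p\<^sub>3)\<close> is bounded below on all
  simplices by a positive constant which does not depend on the number of variables
  (\<open>weighted_variance_bounded_below\<close>). The bound survives the passage to the closure, whereas the
  functional vanishes at the point of the curve with parameter \<open>t\<close>. The elementary symmetric
  polynomials are reduced to this by Newton's identities of degrees \<open>2\<close> and \<open>3\<close>.

  So membership in the limit set changes infinitely often as \<open>t\<close> decreases to \<open>0\<close>. For a
  semialgebraic set that is impossible, because a univariate real polynomial has constant sign
  just to the right of \<open>0\<close> (\<open>semialgebraic_along_curve\<close>).
\<close>

section \<open>Semialgebraic sets along polynomial curves\<close>

text \<open>
  The lowest nonzero coefficient decides the sign, so the induction on coefficients strips factors
  of the positive number \<open>t\<close> until a nonzero constant term is reached.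
\<close>

lemma poly_sign_at_right_0:
  fixes p :: "real poly"
  shows "(\<forall>\<^sub>F t in at_right 0. 0 < poly p t) \<or> (\<forall>\<^sub>F t in at_right 0. \<not> 0 < poly p t)"
proof (induction p)
  case 0
  then show ?case by simp
next
  case (pCons a p)
  have lim: "(poly (pCons a p) \<longlongrightarrow> a) (at_right 0)"
  proof -
    have "(poly (pCons a p) \<longlongrightarrow> poly (pCons a p) 0) (at_right 0)"
      by (intro isCont_tendsto_compose[OF poly_isCont] tendsto_ident_at)
    then show ?thesis by simp
  qed
  consider "a > 0" | "a < 0" | "a = 0" by linarith
  then show ?case
  proof cases
    case 1
    then show ?thesis using order_tendstoD(1)[OF lim, of 0] by blast
  next
    case 2
    then have "\<forall>\<^sub>F t in at_right 0. poly (pCons a p) t < 0"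
      using order_tendstoD(2)[OF lim, of 0] by blast
    then have "\<forall>\<^sub>F t in at_right 0. \<not> 0 < poly (pCons a p) t"
      by (rule eventually_mono) simp
    then show ?thesis ..
  next
    case 3
    have pos: "\<forall>\<^sub>F t in at_right 0. (0::real) < t"
      by (rule eventually_at_right_less)
    from pCons.IH show ?thesis
    proof
      assume "\<forall>\<^sub>F t in at_right 0. 0 < poly p t"
      with pos have "\<forall>\<^sub>F t in at_right 0. 0 < poly (pCons a p) t"
        by eventually_elim (simp add: 3)
      then show ?thesis ..
    next
      assume "\<forall>\<^sub>F t in at_right 0. \<not> 0 < poly p t"
      with pos have "\<forall>\<^sub>F t in at_right 0. \<not> 0 < poly (pCons a p) t"
        by eventually_elim (simp add: 3 zero_less_mult_iff)
      then show ?thesis ..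
    qed
  qed
qed

lemma poly_eval_along_curve:
  fixes q :: "nat \<Rightarrow> real poly"
  shows "\<exists>Q. \<forall>t. poly_eval f (\<lambda>i. poly (q i) t) = poly Q t"
proof (intro exI allI)
  fix t
  show "poly_eval f (\<lambda>i. poly (q i) t) =
      poly (\<Sum>a \<in> Poly_Mapping.keys f. smult (Poly_Mapping.lookup f a)
        (\<Prod>i \<in> Poly_Mapping.keys a. q i ^ Poly_Mapping.lookup a i)) t"
    by (simp add: poly_eval_def poly_sum poly_prod)
qed

lemma eventually_decided_conj:
  assumes "(\<forall>\<^sub>F t in F. P t) \<or> (\<forall>\<^sub>F t in F. \<not> P t)" "(\<forall>\<^sub>F t in F. Q t) \<or> (\<forall>\<^sub>F t in F. \<not> Q t)"
  shows "(\<forall>\<^sub>F t in F. P t \<and> Q t) \<or> (\<forall>\<^sub>F t in F. \<not> (P t \<and> Q t))"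
proof (cases "(\<forall>\<^sub>F t in F. P t) \<and> (\<forall>\<^sub>F t in F. Q t)")
  case True
  then show ?thesis by (simp add: eventually_conj_iff)
next
  case False
  with assms have "(\<forall>\<^sub>F t in F. \<not> P t) \<or> (\<forall>\<^sub>F t in F. \<not> Q t)" by blast
  then have "\<forall>\<^sub>F t in F. \<not> (P t \<and> Q t)"
    by (elim disjE) (erule eventually_mono, simp)+
  then show ?thesis ..
qed

lemma semialgebraic_along_curve:
  fixes q :: "nat \<Rightarrow> real poly"
  assumes "semialgebraic m A" and q: "\<And>i. i \<ge> m \<Longrightarrow> q i = 0"
  shows "(\<forall>\<^sub>F t in at_right 0. (\<lambda>i. poly (q i) t) \<in> A) \<or>
         (\<forall>\<^sub>F t in at_right 0. (\<lambda>i. poly (q i) t) \<notin> A)"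
  using assms(1)
proof induction
  case (pos f)
  obtain Q where "\<And>t. poly_eval f (\<lambda>i. poly (q i) t) = poly Q t"
    using poly_eval_along_curve by blast
  then show ?case
    using poly_sign_at_right_0[of Q] q by (simp add: topspace_Euclidean_space)
next
  case (union A B)
  from union.IH eventually_decided_conj[of "\<lambda>t. (\<lambda>i. poly (q i) t) \<notin> A" "at_right 0"
      "\<lambda>t. (\<lambda>i. poly (q i) t) \<notin> B"]
  show ?case by auto
next
  case (inter A B)
  from eventually_decided_conj[OF inter.IH] show ?case by simp
next
  case (compl A)
  then show ?case using q by (auto simp: topspace_Euclidean_space)
qed

text \<open>
  The sample points \<open>1 / m\<close> and \<open>2 / (2 m + 1)\<close> alternate and tend to \<open>0\<close>; the second one lies
  strictly between \<open>1 / (m + 1)\<close> and \<open>1 / m\<close>.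
\<close>

lemma not_semialgebraic_if_oscillating:
  fixes q :: "nat \<Rightarrow> real poly"
  assumes q: "\<And>i. i \<ge> k \<Longrightarrow> q i = 0"
    and mem: "\<And>m. m \<ge> 1 \<Longrightarrow> (\<lambda>i. poly (q i) (1 / real m)) \<in> A"
    and notmem: "\<And>m. m \<ge> 1 \<Longrightarrow> (\<lambda>i. poly (q i) (2 / (2 * real m + 1))) \<notin> A"
  shows "\<not> semialgebraic k A"
proof
  assume "semialgebraic k A"
  from semialgebraic_along_curve[where q = q, OF this q]
  \<comment> \<open>\<open>P\<close> records whether the curve is finally inside or finally outside of \<open>A\<close>.\<close>
  obtain P where ev: "\<forall>\<^sub>F t in at_right 0. P ((\<lambda>i. poly (q i) t) \<in> A)" and P: "P = id \<or> P = Not"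
    by fastforce
  then obtain b where b: "b > 0" "\<And>t. 0 < t \<Longrightarrow> t < b \<Longrightarrow> P ((\<lambda>i. poly (q i) t) \<in> A)"
    unfolding eventually_at_right_field by auto
  obtain m where m: "m > 0" "inverse (real m) < b"
    using b(1) ex_inverse_of_nat_less by blast
  have "2 / (2 * real m + 1) < inverse (real m)"
    using m(1) by (simp add: field_simps)
  with m have "P ((\<lambda>i. poly (q i) (1 / real m)) \<in> A)" "P ((\<lambda>i. poly (q i) (2 / (2 * real m + 1))) \<in> A)"
    by (auto intro!: b(2) simp: inverse_eq_divide)
  with P mem[of m] notmem[of m] m(1) show False by auto
qed

section \<open>The separating functional\<close>

text \<open>
  Were the sum tiny, all but a small part of the mass would sit on entries within \<open>r\<close> of \<open>t\<close>.
  More than \<open>m\<close> such entries are needed to carry this mass, and \<open>m + 1\<close> of them already exceed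
  the total mass \<open>1\<close>.
\<close>

lemma weighted_variance_bounded_below:
  fixes t :: real
  assumes lo: "1 < real (m + 1) * t" and hi: "real m * t < 1"
  obtains c where "c > 0"
    "\<And>(I :: 'a set) x. finite I \<Longrightarrow> (\<And>i. i \<in> I \<Longrightarrow> 0 \<le> x i) \<Longrightarrow> sum x I = 1 \<Longrightarrow>
       c \<le> (\<Sum>i\<in>I. x i * (x i - t)\<^sup>2)"
proof -
  \<comment> \<open>Dividing the smaller slack \<open>g\<close> by \<open>m + 2\<close> leaves both inequalities strict
    after \<open>t\<close> is replaced by \<open>t - r\<close> in the first and by \<open>t + r\<close> in the second.\<close>
  define g where "g = min (real (m + 1) * t - 1) (1 - real m * t)"
  define r where "r = g / real (m + 2)"
  have r: "r > 0" using lo hi by (simp add: g_def r_def)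
  have "real (m + 2) * r = g" by (simp add: r_def)
  moreover have "g \<le> real (m + 1) * t - 1" "g \<le> 1 - real m * t" by (simp_all add: g_def)
  ultimately have "real (m + 1) * r < real (m + 1) * t - 1" and "real m * r < 1 - real m * t"
    using r by (simp_all add: algebra_simps)
  then have lo': "1 < real (m + 1) * (t - r)" and hi': "real m * (t + r) < 1"
    by (simp_all add: algebra_simps)
  have t: "t > r" using lo' by (smt (verit) mult_nonneg_nonpos of_nat_0_le_iff)
  show thesis
  proof
    show "0 < (1 - real m * (t + r)) * r\<^sup>2" using r hi' by simp
  next
    fix I :: "'a set" and x :: "'a \<Rightarrow> real"
    assume fin: "finite I" and nn: "\<And>i. i \<in> I \<Longrightarrow> 0 \<le> x i" and one: "sum x I = 1"
    define S where "S = {i \<in> I. \<bar>x i - t\<bar> < r}"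
    have S: "finite S" "S \<subseteq> I" using fin by (auto simp: S_def)
    show "(1 - real m * (t + r)) * r\<^sup>2 \<le> (\<Sum>i\<in>I. x i * (x i - t)\<^sup>2)"
    proof (rule ccontr)
      assume neg: "\<not> ?thesis"
      have "sum x (I - S) * r\<^sup>2 = (\<Sum>i\<in>I - S. x i * r\<^sup>2)"
        by (simp add: sum_distrib_right)
      also have "\<dots> \<le> (\<Sum>i\<in>I - S. x i * (x i - t)\<^sup>2)"
        using nn r by (intro sum_mono mult_left_mono) (auto simp: S_def abs_le_square_iff[symmetric])
      also have "\<dots> \<le> (\<Sum>i\<in>I. x i * (x i - t)\<^sup>2)"
        using fin nn by (intro sum_mono2) auto
      also have "\<dots> < (1 - real m * (t + r)) * r\<^sup>2" using neg by simp
      finally have "sum x (I - S) < 1 - real m * (t + r)" using r by simp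
      moreover have "sum x I = sum x (I - S) + sum x S"
        using fin S by (simp add: sum.subset_diff)
      ultimately have mass: "real m * (t + r) < sum x S" using one by simp
      also have "\<dots> \<le> real (card S) * (t + r)"
        by (rule sum_bounded_above) (auto simp: S_def)
      finally have "m + 1 \<le> card S" using r t by simp
      then have "real (m + 1) * (t - r) \<le> real (card S) * (t - r)"
        using t by (intro mult_right_mono) auto
      also have "\<dots> \<le> sum x S"
        by (rule sum_bounded_below) (auto simp: S_def)
      also have "\<dots> \<le> 1" unfolding one[symmetric] using fin S nn by (intro sum_mono2) auto
      finally show False using lo' by simp
    qed
  qed
qed

lemma standard_simplex_pred_iff:
  assumes "n \<ge> 1"
  shows "x \<in> standard_simplex (n - 1) \<longleftrightarrow>
    (\<forall>i. 0 \<le> x i \<and> x i \<le> 1) \<and> (\<forall>i\<ge>n. x i = 0) \<and> (\<Sum>i<n. x i) = 1"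
proof -
  have "{..n - 1} = {..<n}" and "\<And>i. i > n - 1 \<longleftrightarrow> i \<ge> n" using assms by auto
  then show ?thesis by (simp add: standard_simplex_def)
qed

lemma power_sum_functional_bounded_below:
  assumes "m \<ge> 1" "t = 2 / (2 * real m + 1)"
  obtains c where "c > 0"
    "\<And>n x. n \<ge> 1 \<Longrightarrow> x \<in> standard_simplex (n - 1) \<Longrightarrow>
       c \<le> power_sum n 3 x - 2 * t * power_sum n 2 x + t\<^sup>2"
proof -
  have "1 < real (m + 1) * t" "real m * t < 1" using assms(1) unfolding assms(2) by (simp_all add: field_simps)
  note bound = weighted_variance_bounded_below[OF this]
  obtain c where c: "c > 0" "\<And>(I :: nat set) x. finite I \<Longrightarrow> (\<And>i. i \<in> I \<Longrightarrow> 0 \<le> x i) \<Longrightarrow> sum x I = 1 \<Longrightarrow>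
       c \<le> (\<Sum>i\<in>I. x i * (x i - t)\<^sup>2)" using bound[where ?'a = nat] by blast
  show thesis
  proof
    fix n x assume "n \<ge> 1" "x \<in> standard_simplex (n - 1)"
    then have x: "\<And>i. 0 \<le> x i" "(\<Sum>i<n. x i) = 1"
      by (simp_all add: standard_simplex_pred_iff del: One_nat_def)
    have "(\<Sum>i<n. x i * (x i - t)\<^sup>2) = (\<Sum>i<n. x i ^ 3 - 2 * t * x i ^ 2 + t\<^sup>2 * x i)"
      by (intro sum.cong) (auto simp: power2_eq_square power3_eq_cube algebra_simps)
    also have "\<dots> = power_sum n 3 x - 2 * t * power_sum n 2 x + t\<^sup>2"
      using x(2) by (simp add: power_sum_def sum.distrib sum_subtractf flip: sum_distrib_left)
    finally show "c \<le> power_sum n 3 x - 2 * t * power_sum n 2 x + t\<^sup>2"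
      using c(2)[of "{..<n}" x] x by simp
  qed fact
qed

text \<open>
  The preimage of \<open>{c..}\<close> under \<open>f\<close> is closed. Applied to the separating functional, this carries
  the bound from the images of the simplices to the limit sets.
\<close>

lemma le_on_closure_of:
  fixes f :: "'a \<Rightarrow> real"
  assumes "continuous_map X euclideanreal f" and "\<And>y. y \<in> S \<Longrightarrow> c \<le> f y"
    and "x \<in> X closure_of S"
  shows "c \<le> f x"
proof -
  have "f x \<in> euclideanreal closure_of (f ` S)"
    using continuous_map_image_closure_subset[OF assms(1)] assms(3) by blast
  also have "\<dots> \<subseteq> {c..}"
    using assms(2) by (intro closure_of_minimal) auto
  finally show ?thesis by simp
qed

lemma continuous_map_Euclidean_space_coordinate:
  "continuous_map (Euclidean_space k) euclideanreal (\<lambda>x. x i)"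
  unfolding Euclidean_space_def
  by (intro continuous_map_from_subtopology continuous_map_product_projection) simp

section \<open>Elementary symmetric polynomials\<close>

lemma elem_sym_0 [simp]: "elem_sym n 0 x = 1"
proof -
  have "finite I" if "I \<subseteq> {..<n}" for I
    using that by (rule finite_subset) simp
  then have "{I. I \<subseteq> {..<n} \<and> card I = 0} = {{}}"
    by (auto simp: card_eq_0_iff)
  then show ?thesis by (simp add: elem_sym_def)
qed

lemma elem_sym_0_Suc [simp]: "elem_sym 0 (Suc k) x = 0"
proof -
  have "{I. I \<subseteq> {..<0::nat} \<and> card I = Suc k} = {}" by auto
  then show ?thesis by (simp only: elem_sym_def) simp
qed

text \<open>
  The index sets are split according to whether they contain the last variable.
\<close>

lemma elem_sym_Suc_Suc:
  "elem_sym (Suc n) (Suc k) x = elem_sym n (Suc k) x + x n * elem_sym n k x"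
proof -
  let ?F = "\<lambda>(n::nat) k. {I. I \<subseteq> {..<n} \<and> card I = k}"
  have fin: "finite (?F n k)" for n k by (rule finite_subset[of _ "Pow {..<n}"]) auto
  have finI: "finite I" if "I \<subseteq> {..<n}" for I :: "nat set" using that by (rule finite_subset) simp
  have split: "?F (Suc n) (Suc k) = ?F n (Suc k) \<union> insert n ` ?F n k"
  proof (intro equalityI subsetI)
    fix I assume I: "I \<in> ?F (Suc n) (Suc k)"
    show "I \<in> ?F n (Suc k) \<union> insert n ` ?F n k"
    proof (cases "n \<in> I")
      case True
      have "I - {n} \<in> ?F n k" using I True by (auto simp: less_Suc_eq)
      moreover have "I = insert n (I - {n})" using True by auto
      ultimately show ?thesis by blast
    next
      case False
      then show ?thesis using I by (auto simp: less_Suc_eq)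
    qed
  next
    fix I assume "I \<in> ?F n (Suc k) \<union> insert n ` ?F n k"
    then show "I \<in> ?F (Suc n) (Suc k)"
      by (auto simp: card_insert_if finI subset_iff less_Suc_eq)
  qed
  have disj: "?F n (Suc k) \<inter> insert n ` ?F n k = {}" by auto
  have inj: "inj_on (insert n) (?F n k)"
    by (rule inj_on_inverseI[where g = "\<lambda>I. I - {n}"]) auto
  have "elem_sym (Suc n) (Suc k) x =
      elem_sym n (Suc k) x + (\<Sum>I\<in>?F n k. \<Prod>i\<in>insert n I. x i)"
    unfolding elem_sym_def split
    by (subst sum.union_disjoint) (use fin disj in \<open>simp_all add: sum.reindex[OF inj]\<close>)
  also have "(\<Sum>I\<in>?F n k. \<Prod>i\<in>insert n I. x i) = (\<Sum>I\<in>?F n k. x n * (\<Prod>i\<in>I. x i))"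
    by (intro sum.cong refl prod.insert) (auto simp: finI)
  finally show ?thesis by (simp add: elem_sym_def sum_distrib_left)
qed

lemma elem_sym_1: "elem_sym n (Suc 0) x = power_sum n 1 x"
  by (induction n) (simp_all add: elem_sym_Suc_Suc power_sum_def)

lemma newton_2: "(power_sum n 1 x)\<^sup>2 = power_sum n 2 x + 2 * elem_sym n 2 x"
proof (induction n)
  case 0
  then show ?case by (simp add: power_sum_def numeral_2_eq_2)
next
  case (Suc n)
  have "elem_sym (Suc n) 2 x = elem_sym n 2 x + x n * power_sum n 1 x"
    by (simp add: numeral_2_eq_2 elem_sym_Suc_Suc elem_sym_1)
  with Suc show ?case by (simp add: power_sum_def power2_sum)
qed

lemma newton_3:
  "power_sum n 3 x =
     power_sum n 1 x * power_sum n 2 x - power_sum n 1 x * elem_sym n 2 x + 3 * elem_sym n 3 x"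
proof (induction n)
  case 0
  then show ?case by (simp add: power_sum_def numeral_3_eq_3)
next
  case (Suc n)
  have e: "elem_sym (Suc n) 2 x = elem_sym n 2 x + x n * power_sum n 1 x"
    "elem_sym (Suc n) 3 x = elem_sym n 3 x + x n * elem_sym n 2 x"
    by (simp_all add: numeral_2_eq_2 numeral_3_eq_3 elem_sym_Suc_Suc elem_sym_1)
  have p: "power_sum (Suc n) 1 x = power_sum n 1 x + x n"
    "power_sum (Suc n) 2 x = power_sum n 2 x + (x n)\<^sup>2"
    "power_sum (Suc n) 3 x = power_sum n 3 x + x n ^ 3"
    by (simp_all add: power_sum_def)
  show ?case unfolding e p using Suc newton_2[of n x] by algebra
qed

lemma elem_sym_uniform:
  "elem_sym n k (\<lambda>i. if i < m then c else 0) = real (min n m choose k) * c ^ k"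
proof (induction n arbitrary: k)
  case 0
  then show ?case by (cases k) simp_all
next
  case (Suc n)
  show ?case
  proof (cases k)
    case 0
    then show ?thesis by simp
  next
    case (Suc j)
    show ?thesis
    proof (cases "n < m")
      case True
      then have "min (Suc n) m = Suc n" "min n m = n" by auto
      with True Suc Suc.IH show ?thesis by (simp add: elem_sym_Suc_Suc algebra_simps)
    next
      case False
      then have "min (Suc n) m = m" "min n m = m" by auto
      with False Suc Suc.IH show ?thesis by (simp add: elem_sym_Suc_Suc)
    qed
  qed
qed

section \<open>The limit sets along the curve\<close>

lemma uniform_in_standard_simplex:
  assumes "1 \<le> m" "m \<le> n"
  shows "(\<lambda>i. if i < m then 1 / real m else 0) \<in> standard_simplex (n - 1)"
proof -
  have "{..<n} \<inter> {i. i < m} = {..<m}" using assms by auto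
  then have "(\<Sum>i<n. if i < m then 1 / real m else 0) = 1"
    using assms by (simp add: sum.If_cases)
  moreover have "n \<ge> 1" using assms by simp
  ultimately show ?thesis
    unfolding standard_simplex_pred_iff[OF \<open>n \<ge> 1\<close>] using assms by simp
qed

lemma power_sum_uniform:
  assumes "1 \<le> m" "m \<le> n"
  shows "power_sum n (Suc k) (\<lambda>i. if i < m then 1 / real m else 0) = (1 / real m) ^ k"
proof -
  have "{..<n} \<inter> {i. i < m} = {..<m}" using assms by auto
  moreover have "power_sum n (Suc k) (\<lambda>i. if i < m then 1 / real m else 0) =
      (\<Sum>i<n. if i < m then (1 / real m) ^ Suc k else 0)"
    unfolding power_sum_def by (intro sum.cong) auto
  ultimately show ?thesis using assms by (simp add: sum.If_cases)
qed

theorem power_sum_limit_not_semialgebraic: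
  assumes d: "d \<ge> 3"
  shows "\<not> semialgebraic (d - 1) (power_sum_limit d)"
proof -
  define q where "q = (\<lambda>j. if j < d - 1 then monom (1::real) (j + 1) else 0)"
  have mem: "(\<lambda>i. poly (q i) (1 / real m)) \<in> power_sum_limit d" if "m \<ge> 1" for m
  proof -
    let ?u = "\<lambda>i. if i < m then 1 / real m else 0"
    have "(\<lambda>i. poly (q i) (1 / real m)) =
        (\<lambda>j. if j < d - 1 then power_sum (max m d) (j + 2) ?u else 0)"
      using power_sum_uniform[OF that, of "max m d"] by (auto simp: q_def poly_monom fun_eq_iff)
    then have "(\<lambda>i. poly (q i) (1 / real m)) \<in> power_sum_image (max m d) d"
      unfolding power_sum_image_def using uniform_in_standard_simplex[OF that, of "max m d"] by auto
    moreover have "(\<Union>n\<in>{d..}. power_sum_image n d) \<subseteq> topspace (Euclidean_space (d - 1))"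
      by (auto simp: power_sum_image_def topspace_Euclidean_space)
    ultimately show ?thesis
      unfolding power_sum_limit_def using closure_of_subset by fastforce
  qed
  have notmem: "(\<lambda>i. poly (q i) (2 / (2 * real m + 1))) \<notin> power_sum_limit d" if m: "m \<ge> 1" for m
  proof
    define t where "t = 2 / (2 * real m + 1)"
    assume "(\<lambda>i. poly (q i) (2 / (2 * real m + 1))) \<in> power_sum_limit d"
    then have mem: "(\<lambda>i. poly (q i) t) \<in> power_sum_limit d" unfolding t_def .
    obtain c where c: "c > 0" "\<And>n x. n \<ge> 1 \<Longrightarrow> x \<in> standard_simplex (n - 1) \<Longrightarrow>
        c \<le> power_sum n 3 x - 2 * t * power_sum n 2 x + t\<^sup>2"
      using power_sum_functional_bounded_below[OF m t_def] by blast
    have "c \<le> (\<lambda>y. y 1 - 2 * t * y 0 + t\<^sup>2) (\<lambda>i. poly (q i) t)"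
    proof (rule le_on_closure_of[OF _ _ mem[unfolded power_sum_limit_def]])
      show "continuous_map (Euclidean_space (d - 1)) euclideanreal (\<lambda>y. y 1 - 2 * t * y 0 + t\<^sup>2)"
        by (intro continuous_map_add continuous_map_diff continuous_map_real_mult
            continuous_map_Euclidean_space_coordinate continuous_map_const[THEN iffD2]) auto
      show "c \<le> y 1 - 2 * t * y 0 + t\<^sup>2" if "y \<in> (\<Union>n\<in>{d..}. power_sum_image n d)" for y
        using that c(2) d by (auto simp: power_sum_image_def numeral_3_eq_3 numeral_2_eq_2)
    qed
    moreover have "0 < d - 1" "1 < d - 1" using d by auto
    ultimately show False using c(1) by (simp add: q_def poly_monom power2_eq_square)
  qed
  show ?thesis
    by (rule not_semialgebraic_if_oscillating[OF _ mem notmem]) (simp_all add: q_def)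
qed

theorem elem_sym_limit_not_semialgebraic:
  assumes d: "d \<ge> 3"
  shows "\<not> semialgebraic (d - 1) (elem_sym_limit d)"
proof -
  define q where "q = (\<lambda>j. if j < d - 1
    then smult (1 / fact (j + 2)) (\<Prod>i<j + 2. [:1, - real i:]) else 0)"
  have mem: "(\<lambda>i. poly (q i) (1 / real m)) \<in> elem_sym_limit d" if "m \<ge> 1" for m
  proof -
    let ?u = "\<lambda>i. if i < m then 1 / real m else 0"
    \<comment> \<open>The value of \<open>e\<^sub>k\<close> at the uniform vector is a polynomial in \<open>1 / m\<close>,
      since the binomial coefficient is a falling factorial over \<open>k!\<close>.\<close>
    have bin: "(\<Prod>i<k. 1 - real i / real m) / fact k = real (m choose k) * (1 / real m) ^ k" for k
    proof -
      have "(\<Prod>i<k. 1 - real i / real m) = (\<Prod>i<k. (real m - real i) * (1 / real m))"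
        using that by (intro prod.cong) (auto simp: field_simps)
      also have "\<dots> = (\<Prod>i<k. real m - real i) * (1 / real m) ^ k"
        by (subst prod.distrib) simp
      finally show ?thesis
        by (simp add: binomial_gbinomial gbinomial_prod_rev atLeast0LessThan)
    qed
    have elem: "elem_sym (max m d) k ?u = real (m choose k) * (1 / real m) ^ k" for k
      by (subst elem_sym_uniform) simp
    have "poly (q j) (1 / real m) = (\<Prod>i<j + 2. 1 - real i / real m) / fact (j + 2)"
      if "j < d - 1" for j
      using that unfolding q_def by (simp only: poly_prod poly_smult if_True) simp
    then have val: "poly (q j) (1 / real m) = elem_sym (max m d) (j + 2) ?u" if "j < d - 1" for j
      unfolding bin elem using that by blast
    have "q j = 0" if "\<not> j < d - 1" for j
      using that by (simp add: q_def)
    with val have "(\<lambda>i. poly (q i) (1 / real m)) =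
        (\<lambda>j. if j < d - 1 then elem_sym (max m d) (j + 2) ?u else 0)"
      by (intro ext) simp
    then have "(\<lambda>i. poly (q i) (1 / real m)) \<in> elem_sym_image (max m d) d"
      unfolding elem_sym_image_def using uniform_in_standard_simplex[OF that, of "max m d"] by auto
    moreover have "(\<Union>n\<in>{d..}. elem_sym_image n d) \<subseteq> topspace (Euclidean_space (d - 1))"
      by (auto simp: elem_sym_image_def topspace_Euclidean_space)
    ultimately show ?thesis
      unfolding elem_sym_limit_def using closure_of_subset by fastforce
  qed
  have notmem: "(\<lambda>i. poly (q i) (2 / (2 * real m + 1))) \<notin> elem_sym_limit d" if m: "m \<ge> 1" for m
  proof
    define t where "t = 2 / (2 * real m + 1)"
    assume "(\<lambda>i. poly (q i) (2 / (2 * real m + 1))) \<in> elem_sym_limit d"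
    then have mem: "(\<lambda>i. poly (q i) t) \<in> elem_sym_limit d" unfolding t_def .
    obtain c where c: "c > 0" "\<And>n x. n \<ge> 1 \<Longrightarrow> x \<in> standard_simplex (n - 1) \<Longrightarrow>
        c \<le> power_sum n 3 x - 2 * t * power_sum n 2 x + t\<^sup>2"
      using power_sum_functional_bounded_below[OF m t_def] by blast
    \<comment> \<open>With \<open>p\<^sub>1 = 1\<close> one has \<open>p\<^sub>2 = 1 - 2 e\<^sub>2\<close> and \<open>p\<^sub>3 = 1 - 3 e\<^sub>2 + 3 e\<^sub>3\<close>,
      so the separating functional is affine in \<open>(e\<^sub>2, e\<^sub>3)\<close> as well.\<close>
    let ?g = "\<lambda>y. 1 - 3 * y 0 + 3 * y 1 - 2 * t * (1 - 2 * y 0) + t\<^sup>2"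
    have "c \<le> ?g (\<lambda>i. poly (q i) t)"
    proof (rule le_on_closure_of[OF _ _ mem[unfolded elem_sym_limit_def]])
      show "continuous_map (Euclidean_space (d - 1)) euclideanreal ?g"
        by (intro continuous_map_add continuous_map_diff continuous_map_real_mult
            continuous_map_Euclidean_space_coordinate continuous_map_const[THEN iffD2]) auto
      show "c \<le> ?g y" if "y \<in> (\<Union>n\<in>{d..}. elem_sym_image n d)" for y
      proof -
        from that obtain n x where n: "n \<ge> d" and x: "x \<in> standard_simplex (n - 1)"
          and y: "y = (\<lambda>j. if j < d - 1 then elem_sym n (j + 2) x else 0)"
          by (auto simp: elem_sym_image_def)
        have y01: "y 0 = elem_sym n 2 x" "y 1 = elem_sym n 3 x"
          using d by (auto simp: y numeral_3_eq_3 numeral_2_eq_2)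
        have "power_sum n 1 x = 1"
          using x n d by (simp add: standard_simplex_pred_iff power_sum_def del: One_nat_def)
        then have p: "power_sum n 2 x = 1 - 2 * y 0" "power_sum n 3 x = 1 - 3 * y 0 + 3 * y 1"
          using newton_2[of n x] newton_3[of n x] y01 by simp_all
        have "c \<le> power_sum n 3 x - 2 * t * power_sum n 2 x + t\<^sup>2"
          using c(2) x n d by simp
        then show ?thesis unfolding p .
      qed
    qed
    moreover have "poly (q 0) t = (1 - t) / 2"
      using d by (simp add: q_def numeral_2_eq_2)
    moreover have "poly (q 1) t = (1 - t) * (1 - 2 * t) / 6"
      using d by (simp add: q_def eval_nat_numeral) (simp add: field_simps)
    ultimately have "c \<le> 1 - 3 * ((1 - t) / 2) + 3 * ((1 - t) * (1 - 2 * t) / 6)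
        - 2 * t * (1 - 2 * ((1 - t) / 2)) + t\<^sup>2"
      by (simp only:)
    also have "\<dots> = 0" by (simp add: field_simps power2_eq_square)
    finally show False using c(1) by simp
  qed
  show ?thesis
    by (rule not_semialgebraic_if_oscillating[OF _ mem notmem]) (simp_all add: q_def)
qed

theorem corollary2p25:
  fixes d :: nat
  assumes "d \<ge> 3"
  shows "\<not> semialgebraic (d - 1) (power_sum_limit d) \<and>
         \<not> semialgebraic (d - 1) (elem_sym_limit d)"
  using power_sum_limit_not_semialgebraic[OF assms] elem_sym_limit_not_semialgebraic[OF assms] ..

end
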